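(* Suppose $X$ is an almost discrete Tychonoff space. Then: (a) $\mathrm{dt}_t(\mathbb{AG}(C(X))) = |I(X)|$. (b) If $|X| > 2$, then $\mathrm{dt}(\mathbb{AG}(C(X))) = |I(X)|$.
   Context: $C(X)$ is the ring of all real-valued continuous functions on $X$. $I(X)$ is the set of isolated points of $X$; $X$ is almost discrete if $\overline{I(X)}=X$. For a commutative ring $R$ and $S\subseteq R$, $\mathrm{Ann}(S)=\{x\in R: Sx=\{0\}\}$; $\mathbb{A}(R)^*$ is the set of non-zero ideals $I$ of $R$ with $\mathrm{Ann}(I)\neq\{0\}$; the annihilating-ideal graph $\mathbb{AG}(R)$ has vertex set $\mathbb{A}(R)^*$, distinct $I,J$ being adjacent iff $IJ=\{0\}$. For a graph $G$, a dominating set is a set $D$ of vertices such that every vertex is in $D$ or adjacent to some vertex of $D$; a total dominating set is a set $S$ of vertices such that every vertex is adjacent to some vertex of $S$; $\mathrm{dt}(G)$ and $\mathrm{dt}_t(G)$ are the minimum cardinalities of a dominating set and of a total dominating set, respectively.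
   Formalization: Part (a) is stated only for X that is not a one-point space: if |X| = 1 then C(X) is a field, the graph has no vertices, so dt_t = 0 while |I(X)| = 1. *)

theory Defs
  imports
    "HOL-Analysis.Analysis"
    "HOL-Algebra.Ideal_Product"
    "Graph_Theory.Pair_Digraph"
begin

unbundle cardinal_syntax

section \<open>Topological spaces and rings of continuous functions\<close>

definition tychonoff_space :: "'a topology \<Rightarrow> bool" where
  "tychonoff_space X \<longleftrightarrow> completely_regular_space X \<and> Hausdorff_space X"

definition isolated_points :: "'a topology \<Rightarrow> 'a set" where
  "isolated_points X = {x \<in> topspace X. openin X {x}}"

definition almost_discrete_space :: "'a topology \<Rightarrow> bool" where
  "almost_discrete_space X \<longleftrightarrow> Abstract_Topology.closure_of X (isolated_points X) = topspace X"

text \<open>Functions on the space are represented by the total functions that are \<^term>\<open>undefined\<close>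
  outside \<^term>\<open>topspace X\<close>, so that equality in the ring is equality of functions on the space.\<close>

definition cont_ring :: "'a topology \<Rightarrow> ('a \<Rightarrow> real) ring" where
  "cont_ring X = \<lparr>
     carrier = {f \<in> extensional (topspace X). continuous_map X euclideanreal f},
     mult = (\<lambda>f g. \<lambda>x\<in>topspace X. f x * g x),
     one = (\<lambda>x\<in>topspace X. 1),
     zero = (\<lambda>x\<in>topspace X. 0),
     add = (\<lambda>f g. \<lambda>x\<in>topspace X. f x + g x)\<rparr>"

lemma cont_ring_carrierI:
  "continuous_map X euclideanreal f \<Longrightarrow> restrict f (topspace X) \<in> carrier (cont_ring X)"
  by (auto simp: cont_ring_def intro: continuous_map_eq)

lemma cont_ring_carrierD:
  "f \<in> carrier (cont_ring X) \<Longrightarrow> continuous_map X euclideanreal f"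
  "f \<in> carrier (cont_ring X) \<Longrightarrow> f \<in> extensional (topspace X)"
  by (simp_all add: cont_ring_def)

lemma cont_ring_ops:
  "f \<otimes>\<^bsub>cont_ring X\<^esub> g = (\<lambda>x\<in>topspace X. f x * g x)"
  "f \<oplus>\<^bsub>cont_ring X\<^esub> g = (\<lambda>x\<in>topspace X. f x + g x)"
  "\<one>\<^bsub>cont_ring X\<^esub> = (\<lambda>x\<in>topspace X. 1)"
  "\<zero>\<^bsub>cont_ring X\<^esub> = (\<lambda>x\<in>topspace X. 0)"
  by (simp_all add: cont_ring_def)

lemma cring_cont_ring: "cring (cont_ring X)"
proof -
  let ?R = "cont_ring X"
  have zero_one: "\<zero>\<^bsub>?R\<^esub> \<in> carrier ?R" "\<one>\<^bsub>?R\<^esub> \<in> carrier ?R"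
    using cont_ring_carrierI[of X "\<lambda>x. 0"] cont_ring_carrierI[of X "\<lambda>x. 1"]
    by (simp_all add: cont_ring_ops)
  have closed: "f \<oplus>\<^bsub>?R\<^esub> g \<in> carrier ?R" "f \<otimes>\<^bsub>?R\<^esub> g \<in> carrier ?R"
    if "f \<in> carrier ?R" "g \<in> carrier ?R" for f g
    using that[THEN cont_ring_carrierD(1)]
    by (simp_all add: cont_ring_ops cont_ring_carrierI continuous_map_add continuous_map_real_mult)
  have assoc: "(f \<oplus>\<^bsub>?R\<^esub> g) \<oplus>\<^bsub>?R\<^esub> h = f \<oplus>\<^bsub>?R\<^esub> (g \<oplus>\<^bsub>?R\<^esub> h)"
    "(f \<otimes>\<^bsub>?R\<^esub> g) \<otimes>\<^bsub>?R\<^esub> h = f \<otimes>\<^bsub>?R\<^esub> (g \<otimes>\<^bsub>?R\<^esub> h)" for f g h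
    by (auto simp: cont_ring_ops intro!: restrict_ext)
  have comm: "f \<oplus>\<^bsub>?R\<^esub> g = g \<oplus>\<^bsub>?R\<^esub> f" "f \<otimes>\<^bsub>?R\<^esub> g = g \<otimes>\<^bsub>?R\<^esub> f" for f g
    by (auto simp: cont_ring_ops intro!: restrict_ext)
  have distr: "(f \<oplus>\<^bsub>?R\<^esub> g) \<otimes>\<^bsub>?R\<^esub> h = f \<otimes>\<^bsub>?R\<^esub> h \<oplus>\<^bsub>?R\<^esub> g \<otimes>\<^bsub>?R\<^esub> h" for f g h
    by (auto simp: cont_ring_ops algebra_simps intro!: restrict_ext)
  have units: "\<zero>\<^bsub>?R\<^esub> \<oplus>\<^bsub>?R\<^esub> f = f" "\<one>\<^bsub>?R\<^esub> \<otimes>\<^bsub>?R\<^esub> f = f" if "f \<in> carrier ?R" for f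
    using cont_ring_carrierD(2)[OF that]
    by (auto simp: cont_ring_ops extensional_def)
  have neg: "\<exists>g\<in>carrier ?R. g \<oplus>\<^bsub>?R\<^esub> f = \<zero>\<^bsub>?R\<^esub>" if f: "f \<in> carrier ?R" for f
  proof
    show "(\<lambda>x\<in>topspace X. - f x) \<in> carrier ?R"
      using cont_ring_carrierD(1)[OF f] by (simp add: cont_ring_carrierI continuous_map_minus)
    show "(\<lambda>x\<in>topspace X. - f x) \<oplus>\<^bsub>?R\<^esub> f = \<zero>\<^bsub>?R\<^esub>"
      by (auto simp: cont_ring_ops intro!: restrict_ext)
  qed
  show ?thesis
    by (intro cringI abelian_groupI comm_monoidI)
      (assumption | rule zero_one closed assoc comm distr units neg)+
qed


section \<open>The annihilating-ideal graph\<close>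

definition Ann :: "('a, 'b) ring_scheme \<Rightarrow> 'a set \<Rightarrow> 'a set" where
  "Ann R S = {x \<in> carrier R. (\<lambda>s. s \<otimes>\<^bsub>R\<^esub> x) ` S = {\<zero>\<^bsub>R\<^esub>}}"

definition annihilating_ideals :: "('a, 'b) ring_scheme \<Rightarrow> 'a set set" where
  "annihilating_ideals R = {I. ideal I R \<and> I \<noteq> {\<zero>\<^bsub>R\<^esub>} \<and> Ann R I \<noteq> {\<zero>\<^bsub>R\<^esub>}}"

text \<open>An undirected simple graph is represented by a symmetric loop-free digraph without
  parallel arcs; the vertex set may be infinite.\<close>

definition annihilating_ideal_graph :: "('a, 'b) ring_scheme \<Rightarrow> 'a set pair_pre_digraph" where
  "annihilating_ideal_graph R = \<lparr>
     pverts = annihilating_ideals R,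
     parcs = {(I, J). I \<in> annihilating_ideals R \<and> J \<in> annihilating_ideals R \<and> I \<noteq> J \<and>
                      ideal_prod R I J = {\<zero>\<^bsub>R\<^esub>}}\<rparr>"

lemma annihilating_ideal_graph_simple:
  assumes "cring R"
  shows "pair_sym_digraph (annihilating_ideal_graph R)"
    and "pair_loopfree_digraph (annihilating_ideal_graph R)"
proof -
  interpret cring R by fact
  have comm: "ideal_prod R I J = ideal_prod R J I" if "ideal I R" "ideal J R" for I J
    using that by (rule ideal_prod_commute)
  let ?G = "annihilating_ideal_graph R"
  show "pair_sym_digraph ?G"
  proof
    show "symmetric (with_proj ?G)"
      unfolding symmetric_def with_proj_simps
      by (rule symI) (use comm in \<open>auto simp: annihilating_ideal_graph_def annihilating_ideals_def\<close>)
  qed (auto simp: annihilating_ideal_graph_def)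
  show "pair_loopfree_digraph ?G"
    by unfold_locales (auto simp: annihilating_ideal_graph_def)
qed


section \<open>Domination numbers\<close>

definition dominating_set :: "'v pair_pre_digraph \<Rightarrow> 'v set \<Rightarrow> bool" where
  "dominating_set G D \<longleftrightarrow>
     D \<subseteq> pverts G \<and> (\<forall>v\<in>pverts G. v \<in> D \<or> (\<exists>d\<in>D. (v, d) \<in> parcs G))"

definition total_dominating_set :: "'v pair_pre_digraph \<Rightarrow> 'v set \<Rightarrow> bool" where
  "total_dominating_set G S \<longleftrightarrow>
     S \<subseteq> pverts G \<and> (\<forall>v\<in>pverts G. \<exists>s\<in>S. (v, s) \<in> parcs G)"

text \<open>The two domination numbers are possibly infinite cardinals. A cardinal lives on the type of
  some set representing it, so ``the minimum cardinality is \<open>\<kappa>\<close>'' is a relation between the graph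
  and \<open>\<kappa>\<close>: the value \<open>\<kappa>\<close> is attained and is a lower bound. In particular the relation
  fails for every \<open>\<kappa>\<close> if no set of the required kind exists.\<close>

definition is_min_cardinality :: "('v set \<Rightarrow> bool) \<Rightarrow> 'k rel \<Rightarrow> bool" where
  "is_min_cardinality P \<kappa> \<longleftrightarrow> (\<exists>D. P D \<and> |D| =o \<kappa>) \<and> (\<forall>D. P D \<longrightarrow> \<kappa> \<le>o |D| )"

definition has_domination_number :: "'v pair_pre_digraph \<Rightarrow> 'k rel \<Rightarrow> bool" where
  "has_domination_number G \<kappa> \<longleftrightarrow> is_min_cardinality (dominating_set G) \<kappa>"

definition has_total_domination_number :: "'v pair_pre_digraph \<Rightarrow> 'k rel \<Rightarrow> bool" where
  "has_total_domination_number G \<kappa> \<longleftrightarrow> is_min_cardinality (total_dominating_set G) \<kappa>"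

end

theory Submission
  imports Defs
begin

text \<open>For an isolated point \<open>x\<close> let \<open>M\<^sub>x\<close> be the ideal of functions vanishing at \<open>x\<close> and \<open>E\<^sub>x\<close> the
  ideal of functions vanishing off \<open>x\<close>. If \<open>g \<noteq> 0\<close> annihilates an ideal \<open>I\<close>, then the cozero set of
  \<open>g\<close> contains an isolated point \<open>x\<close>, and \<open>I\<close> is adjacent to \<open>E\<^sub>x\<close>; so the ideals \<open>E\<^sub>x\<close> form a total
  dominating set. Conversely \<open>E\<^sub>x\<close> is the only neighbour of \<open>M\<^sub>x\<close>, so a total dominating set contains
  every \<open>E\<^sub>x\<close>, and a dominating set contains \<open>M\<^sub>x\<close> or \<open>E\<^sub>x\<close> for every \<open>x\<close>. With at least three points,
  the ideals picked for different \<open>x\<close> are different.\<close>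

section \<open>Pointwise description of the annihilating-ideal graph of \<open>C(X)\<close>\<close>

lemma cont_ring_carrier_eq_zero_iff:
  assumes "f \<in> carrier (cont_ring X)"
  shows "f = \<zero>\<^bsub>cont_ring X\<^esub> \<longleftrightarrow> (\<forall>x\<in>topspace X. f x = 0)"
proof
  assume "\<forall>x\<in>topspace X. f x = 0"
  then show "f = \<zero>\<^bsub>cont_ring X\<^esub>"
    using cont_ring_carrierD(2)[OF assms]
    by (intro extensionalityI[of _ "topspace X"]) (auto simp: cont_ring_ops)
qed (simp add: cont_ring_ops)

lemma cont_ring_mult_eq_zero_iff:
  "f \<otimes>\<^bsub>cont_ring X\<^esub> g = \<zero>\<^bsub>cont_ring X\<^esub> \<longleftrightarrow> (\<forall>x\<in>topspace X. f x * g x = 0)"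
  by (auto simp: cont_ring_ops restrict_def fun_eq_iff)

lemma cont_ring_ideal_eq_zero_iff:
  assumes "ideal I (cont_ring X)"
  shows "I = {\<zero>\<^bsub>cont_ring X\<^esub>} \<longleftrightarrow> (\<forall>f\<in>I. \<forall>x\<in>topspace X. f x = 0)"
proof -
  interpret ideal I "cont_ring X" by fact
  have "I = {\<zero>\<^bsub>cont_ring X\<^esub>} \<longleftrightarrow> (\<forall>f\<in>I. f = \<zero>\<^bsub>cont_ring X\<^esub>)"
    using additive_subgroup.zero_closed[OF is_additive_subgroup] by blast
  also have "\<dots> \<longleftrightarrow> (\<forall>f\<in>I. \<forall>x\<in>topspace X. f x = 0)"
    using a_subset by (intro ball_cong refl cont_ring_carrier_eq_zero_iff) auto
  finally show ?thesis .
qed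

text \<open>The product ideal is built additively from the products \<open>a \<otimes> b\<close>, so
  it is zero once all of these vanish.\<close>

lemma (in ring) ideal_prod_eq_zero_iff:
  assumes "ideal I R" "ideal J R"
  shows "ideal_prod R I J = {\<zero>} \<longleftrightarrow> (\<forall>a\<in>I. \<forall>b\<in>J. a \<otimes> b = \<zero>)"
proof
  assume zero: "\<forall>a\<in>I. \<forall>b\<in>J. a \<otimes> b = \<zero>"
  have "s = \<zero>" if "s \<in> ideal_prod R I J" for s
    using that by induction (use zero in auto)
  moreover have "\<zero> \<in> ideal_prod R I J"
    using ideal_prod_is_ideal[OF assms] by (simp add: additive_subgroup.zero_closed ideal.axioms(1))
  ultimately show "ideal_prod R I J = {\<zero>}"
    by blast
qed (blast intro: ideal_prod.prod)

lemma annihilating_ideals_cont_ring: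
  "I \<in> annihilating_ideals (cont_ring X) \<longleftrightarrow>
     ideal I (cont_ring X) \<and> (\<exists>f\<in>I. \<exists>x\<in>topspace X. f x \<noteq> 0) \<and>
     (\<exists>g\<in>carrier (cont_ring X). (\<exists>x\<in>topspace X. g x \<noteq> 0) \<and>
        (\<forall>f\<in>I. \<forall>x\<in>topspace X. f x * g x = 0))"
proof (cases "ideal I (cont_ring X)")
  case True
  interpret ideal I "cont_ring X" by (fact True)
  let ?R = "cont_ring X"
  \<comment> \<open>\<open>Ann\<close> asks for the image of \<open>I\<close> to be exactly the zero
    singleton, which fails for an empty set; nonemptiness turns this into a condition on each
    element.\<close>
  have "I \<noteq> {}"
    using additive_subgroup.zero_closed[OF is_additive_subgroup] by blast
  then have "Ann ?R I = {g \<in> carrier ?R. \<forall>f\<in>I. f \<otimes>\<^bsub>?R\<^esub> g = \<zero>\<^bsub>?R\<^esub>}"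
    by (auto simp: Ann_def)
  then have Ann: "Ann ?R I = {g \<in> carrier ?R. \<forall>f\<in>I. \<forall>x\<in>topspace X. f x * g x = 0}"
    by (simp only: cont_ring_mult_eq_zero_iff)
  then have "\<zero>\<^bsub>?R\<^esub> \<in> Ann ?R I"
    using ring.ring_simprules(2)[OF ring_axioms] by (simp add: cont_ring_ops)
  then have "Ann ?R I \<noteq> {\<zero>\<^bsub>?R\<^esub>} \<longleftrightarrow> (\<exists>g\<in>Ann ?R I. g \<noteq> \<zero>\<^bsub>?R\<^esub>)"
    by blast
  also have "\<dots> \<longleftrightarrow> (\<exists>g\<in>Ann ?R I. \<exists>x\<in>topspace X. g x \<noteq> 0)"
    using cont_ring_carrier_eq_zero_iff unfolding Ann by blast
  finally have Ann_nonzero: "Ann ?R I \<noteq> {\<zero>\<^bsub>?R\<^esub>} \<longleftrightarrow>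
      (\<exists>g\<in>carrier ?R. (\<exists>x\<in>topspace X. g x \<noteq> 0) \<and> (\<forall>f\<in>I. \<forall>x\<in>topspace X. f x * g x = 0))"
    unfolding Ann by blast
  have "I \<in> annihilating_ideals ?R \<longleftrightarrow> I \<noteq> {\<zero>\<^bsub>?R\<^esub>} \<and> Ann ?R I \<noteq> {\<zero>\<^bsub>?R\<^esub>}"
    using True by (simp add: annihilating_ideals_def)
  with True show ?thesis
    unfolding Ann_nonzero cont_ring_ideal_eq_zero_iff[OF True] by blast
qed (simp add: annihilating_ideals_def)

text \<open>The condition \<open>I \<noteq> J\<close> is automatic since \<open>C(X)\<close> has no nilpotent elements.\<close>
lemma annihilating_ideal_graph_cont_ring_arc_iff:
  "(I, J) \<in> parcs (annihilating_ideal_graph (cont_ring X)) \<longleftrightarrow>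
     I \<in> annihilating_ideals (cont_ring X) \<and> J \<in> annihilating_ideals (cont_ring X) \<and>
     (\<forall>f\<in>I. \<forall>g\<in>J. \<forall>x\<in>topspace X. f x * g x = 0)"
proof -
  interpret cring "cont_ring X" by (rule cring_cont_ring)
  have prod: "ideal_prod (cont_ring X) I J = {\<zero>\<^bsub>cont_ring X\<^esub>} \<longleftrightarrow>
      (\<forall>f\<in>I. \<forall>g\<in>J. \<forall>x\<in>topspace X. f x * g x = 0)"
    if "I \<in> annihilating_ideals (cont_ring X)" "J \<in> annihilating_ideals (cont_ring X)"
    using that
    by (simp add: ideal_prod_eq_zero_iff annihilating_ideals_def cont_ring_mult_eq_zero_iff)
  have "I \<noteq> J" if "I \<in> annihilating_ideals (cont_ring X)"
      "\<forall>f\<in>I. \<forall>g\<in>J. \<forall>x\<in>topspace X. f x * g x = 0"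
    using that unfolding annihilating_ideals_cont_ring by fastforce
  with prod show ?thesis
    unfolding annihilating_ideal_graph_def pair_pre_digraph.select_convs mem_Collect_eq case_prod_conv
    by blast
qed

section \<open>Ideals of functions vanishing on a set: \<open>{x}\<close> gives
  \<open>M\<^sub>x\<close>, its complement gives \<open>E\<^sub>x\<close>\<close>

definition vanishing_ideal :: "'a topology \<Rightarrow> 'a set \<Rightarrow> ('a \<Rightarrow> real) set" where
  "vanishing_ideal X A = {f \<in> carrier (cont_ring X). \<forall>x\<in>A. f x = 0}"

text \<open>The ring operations return \<open>undefined\<close> off \<open>topspace X\<close>, so
  vanishing on \<open>A\<close> is guaranteed to persist only if \<open>A\<close> lies inside the
  space.\<close>

lemma ideal_vanishing_ideal:
  assumes "A \<subseteq> topspace X"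
  shows "ideal (vanishing_ideal X A) (cont_ring X)"
proof -
  interpret cring "cont_ring X" by (rule cring_cont_ring)
  have inv: "\<ominus>\<^bsub>cont_ring X\<^esub> f \<in> vanishing_ideal X A" if f: "f \<in> vanishing_ideal X A" for f
  proof -
    \<comment> \<open>The additive inverse is given only abstractly; its values are read off from
      its defining equation.\<close>
    have "f \<oplus>\<^bsub>cont_ring X\<^esub> \<ominus>\<^bsub>cont_ring X\<^esub> f = \<zero>\<^bsub>cont_ring X\<^esub>"
      using f r_neg by (simp add: vanishing_ideal_def)
    then have "f x + (\<ominus>\<^bsub>cont_ring X\<^esub> f) x = 0" if "x \<in> topspace X" for x
      using that unfolding cont_ring_ops by (metis (lifting) restrict_apply')
    with f assms show ?thesis
      by (fastforce simp: vanishing_ideal_def)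
  qed
  have "subgroup (vanishing_ideal X A) (add_monoid (cont_ring X))"
  proof (rule add.subgroupI)
    have "\<zero>\<^bsub>cont_ring X\<^esub> \<in> vanishing_ideal X A"
      using assms zero_closed by (auto simp: vanishing_ideal_def cont_ring_ops)
    then show "vanishing_ideal X A \<noteq> {}"
      by blast
    show "f \<oplus>\<^bsub>cont_ring X\<^esub> g \<in> vanishing_ideal X A"
      if "f \<in> vanishing_ideal X A" "g \<in> vanishing_ideal X A" for f g
      using that assms a_closed[of f g]
      by (auto simp: vanishing_ideal_def cont_ring_ops subset_iff)
  qed (use inv in \<open>auto simp: vanishing_ideal_def a_inv_def\<close>)
  moreover have "f \<otimes>\<^bsub>cont_ring X\<^esub> g \<in> vanishing_ideal X A" "g \<otimes>\<^bsub>cont_ring X\<^esub> f \<in> vanishing_ideal X A"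
    if "f \<in> vanishing_ideal X A" "g \<in> carrier (cont_ring X)" for f g
    using that assms m_closed[of f g] m_closed[of g f]
    by (auto simp: vanishing_ideal_def cont_ring_ops subset_iff)
  ultimately show ?thesis
    by (intro idealI ring_axioms) auto
qed

text \<open>The preimage of any set of reals is a union of some of \<open>U\<close> and its
  complement, both of which are open.\<close>

lemma indicator_in_cont_ring:
  assumes "openin X U" "closedin X U"
  shows "(\<lambda>x\<in>topspace X. indicator U x) \<in> carrier (cont_ring X)"
proof (rule cont_ring_carrierI)
  show "continuous_map X euclideanreal (indicator U)"
    unfolding continuous_map_def
  proof (intro conjI allI impI)
    fix V :: "real set"
    have "{x \<in> topspace X. indicator U x \<in> V} =
        (if 1 \<in> V then U else {}) \<union> (if 0 \<in> V then topspace X - U else {})"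
      using openin_subset[OF assms(1)] by (auto simp: indicator_def)
    then show "openin X {x \<in> topspace X. indicator U x \<in> V}"
      using assms by (auto intro!: openin_Un)
  qed auto
qed

section \<open>The two ideals attached to an isolated point\<close>

locale isolated_point =
  fixes X :: "'a topology" and x :: 'a
  assumes t1: "t1_space X"
    and isolated: "x \<in> isolated_points X"
    and not_singleton: "topspace X \<noteq> {x}"
begin

text \<open>\<open>t1\<close> and \<open>isolated\<close> make \<open>{x}\<close> clopen, so both
  functions are continuous. They witness that \<open>E\<^sub>x\<close> and \<open>M\<^sub>x\<close>
  are nonzero, the latter thanks to \<open>not_singleton\<close>.\<close>

abbreviation "point_fun \<equiv> (\<lambda>y\<in>topspace X. indicator {x} y) :: 'a \<Rightarrow> real"
abbreviation "copoint_fun \<equiv> (\<lambda>y\<in>topspace X. indicator (topspace X - {x}) y) :: 'a \<Rightarrow> real"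

lemma point_in_topspace: "x \<in> topspace X"
  using isolated by (simp add: isolated_points_def)

lemma open_point: "openin X {x}"
  using isolated by (simp add: isolated_points_def)

lemma closed_point: "closedin X {x}"
  using t1 point_in_topspace by (simp add: closedin_t1_singleton)

lemma point_fun_in: "point_fun \<in> vanishing_ideal X (topspace X - {x})"
  using indicator_in_cont_ring[OF open_point closed_point]
  by (auto simp: vanishing_ideal_def)

lemma copoint_fun_in: "copoint_fun \<in> vanishing_ideal X {x}"
  using indicator_in_cont_ring[of X "topspace X - {x}"] open_point closed_point point_in_topspace
  by (auto simp: vanishing_ideal_def)

lemma obtain_other_point: obtains z where "z \<in> topspace X" "z \<noteq> x"
  using not_singleton point_in_topspace by blast

lemma vanishing_ideals_mult_zero:
  assumes "f \<in> vanishing_ideal X (topspace X - {x})" "g \<in> vanishing_ideal X {x}" "y \<in> topspace X"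
  shows "f y * g y = 0"
  using assms by (cases "y = x") (auto simp: vanishing_ideal_def)

text \<open>The two ideals annihilate each other and are both nonzero, so each supplies the nonzero
  annihilator that the other needs.\<close>

lemma annihilating_ideals:
  "vanishing_ideal X {x} \<in> annihilating_ideals (cont_ring X)"
  "vanishing_ideal X (topspace X - {x}) \<in> annihilating_ideals (cont_ring X)"
proof -
  obtain z where z: "z \<in> topspace X" "z \<noteq> x" by (rule obtain_other_point)
  have nz: "point_fun x \<noteq> 0" "copoint_fun z \<noteq> 0"
    using z point_in_topspace by auto
  have car: "vanishing_ideal X A \<subseteq> carrier (cont_ring X)" for A
    by (auto simp: vanishing_ideal_def)
  show "vanishing_ideal X {x} \<in> annihilating_ideals (cont_ring X)"
    unfolding annihilating_ideals_cont_ring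
  proof (intro conjI)
    show "ideal (vanishing_ideal X {x}) (cont_ring X)"
      by (rule ideal_vanishing_ideal) (use point_in_topspace in auto)
    show "\<exists>f\<in>vanishing_ideal X {x}. \<exists>y\<in>topspace X. f y \<noteq> 0"
      using copoint_fun_in z(1) nz(2) by (intro bexI)
    show "\<exists>g\<in>carrier (cont_ring X). (\<exists>y\<in>topspace X. g y \<noteq> 0) \<and>
        (\<forall>f\<in>vanishing_ideal X {x}. \<forall>y\<in>topspace X. f y * g y = 0)"
    proof (intro bexI conjI ballI)
      show "point_fun \<in> carrier (cont_ring X)"
        using point_fun_in car by blast
      show "f y * point_fun y = 0" if "f \<in> vanishing_ideal X {x}" "y \<in> topspace X" for f y
        using vanishing_ideals_mult_zero[OF point_fun_in that] by (simp only: mult.commute)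
    qed (rule nz point_in_topspace)+
  qed
  show "vanishing_ideal X (topspace X - {x}) \<in> annihilating_ideals (cont_ring X)"
    unfolding annihilating_ideals_cont_ring
  proof (intro conjI)
    show "ideal (vanishing_ideal X (topspace X - {x})) (cont_ring X)"
      by (rule ideal_vanishing_ideal) auto
    show "\<exists>f\<in>vanishing_ideal X (topspace X - {x}). \<exists>y\<in>topspace X. f y \<noteq> 0"
      using point_fun_in point_in_topspace nz(1) by (intro bexI)
    show "\<exists>g\<in>carrier (cont_ring X). (\<exists>y\<in>topspace X. g y \<noteq> 0) \<and>
        (\<forall>f\<in>vanishing_ideal X (topspace X - {x}). \<forall>y\<in>topspace X. f y * g y = 0)"
    proof (intro bexI conjI ballI)
      show "copoint_fun \<in> carrier (cont_ring X)"
        using copoint_fun_in car by blast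
      show "f y * copoint_fun y = 0"
        if "f \<in> vanishing_ideal X (topspace X - {x})" "y \<in> topspace X" for f y
        using vanishing_ideals_mult_zero[OF that(1) copoint_fun_in that(2)] .
    qed (rule nz z)+
  qed
qed

text \<open>Since \<open>copoint_fun\<close> lies in \<open>M\<^sub>x\<close> and equals 1 off
  \<open>x\<close>, every element of \<open>J\<close> vanishes off \<open>x\<close>. Thus
  \<open>J\<close> is a nonzero ideal inside \<open>E\<^sub>x\<close>, which is one-dimensional over
  the reals, and must fill it.\<close>

lemma unique_neighbour:
  assumes "(vanishing_ideal X {x}, J) \<in> parcs (annihilating_ideal_graph (cont_ring X))"
  shows "J = vanishing_ideal X (topspace X - {x})"
proof
  have zero: "copoint_fun y * g y = 0" if "g \<in> J" "y \<in> topspace X" for g y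
    using assms copoint_fun_in that
    unfolding annihilating_ideal_graph_cont_ring_arc_iff by blast
  have J: "J \<in> annihilating_ideals (cont_ring X)"
    using assms unfolding annihilating_ideal_graph_cont_ring_arc_iff by blast
  then interpret J: ideal J "cont_ring X"
    by (simp add: annihilating_ideals_cont_ring)
  have off: "g y = 0" if "g \<in> J" "y \<in> topspace X - {x}" for g y
    using zero[of g y] that by simp
  then show "J \<subseteq> vanishing_ideal X (topspace X - {x})"
    using J.a_subset by (auto simp: vanishing_ideal_def)
  obtain g where g: "g \<in> J" "g x \<noteq> 0"
    using J off unfolding annihilating_ideals_cont_ring by blast
  show "vanishing_ideal X (topspace X - {x}) \<subseteq> J"
  proof
    fix f assume f: "f \<in> vanishing_ideal X (topspace X - {x})"
    \<comment> \<open>As \<open>f\<close> and \<open>g\<close> both vanish off \<open>x\<close>, \<open>f\<close> is a multiple of \<open>g\<close> by a constant.\<close>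
    let ?c = "\<lambda>y\<in>topspace X. f x / g x"
    have "?c \<in> carrier (cont_ring X)"
      by (rule cont_ring_carrierI) simp
    then have "?c \<otimes>\<^bsub>cont_ring X\<^esub> g \<in> J"
      using g(1) by (rule J.I_l_closed[rotated])
    moreover have "?c \<otimes>\<^bsub>cont_ring X\<^esub> g = f"
    proof (rule extensionalityI)
      show "f \<in> extensional (topspace X)"
        using f cont_ring_carrierD(2)[of f X] by (simp add: vanishing_ideal_def)
      show "(?c \<otimes>\<^bsub>cont_ring X\<^esub> g) y = f y" if "y \<in> topspace X" for y
        using that f off[OF g(1), of y] g(2)
        by (cases "y = x") (auto simp: cont_ring_ops vanishing_ideal_def)
    qed (simp add: cont_ring_ops)
    ultimately show "f \<in> J" by simp
  qed
qed

text \<open>The test function is \<open>copoint_fun\<close>, whose only zero in the space is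
  \<open>x\<close>. This later separates \<open>M\<^sub>x\<close> from every other
  \<open>M\<^sub>y\<close> and from every \<open>E\<^sub>y\<close>.\<close>

lemma vanishing_ideal_point_subset:
  assumes "A \<subseteq> topspace X" and "vanishing_ideal X {x} \<subseteq> vanishing_ideal X A"
  shows "A \<subseteq> {x}"
proof
  fix y assume y: "y \<in> A"
  have "copoint_fun \<in> vanishing_ideal X A"
    using assms(2) copoint_fun_in by (rule subsetD)
  with y have "copoint_fun y = 0"
    unfolding vanishing_ideal_def by blast
  with y assms(1) show "y \<in> {x}"
    by (cases "y = x") auto
qed

lemma point_unique:
  assumes "y \<in> topspace X"
    and "vanishing_ideal X (topspace X - {x}) \<subseteq> vanishing_ideal X (topspace X - {y})"
  shows "x = y"
proof (rule ccontr)
  assume "x \<noteq> y"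
  then have "point_fun x = 0"
    using assms point_fun_in point_in_topspace unfolding vanishing_ideal_def by blast
  then show False
    using point_in_topspace by simp
qed

end

section \<open>Upper bound: the ideals \<open>E\<^sub>x\<close> form a total dominating set\<close>

lemma exists_dominating_isolated_point:
  assumes t1: "t1_space X" and dense: "almost_discrete_space X"
    and nonsing: "\<nexists>x. topspace X = {x}"
    and I: "I \<in> annihilating_ideals (cont_ring X)"
  obtains x where "x \<in> isolated_points X"
    "(I, vanishing_ideal X (topspace X - {x})) \<in> parcs (annihilating_ideal_graph (cont_ring X))"
proof -
  obtain g z where g: "g \<in> carrier (cont_ring X)"
    and z: "z \<in> topspace X" "g z \<noteq> 0"
    and ann: "\<And>f y. f \<in> I \<Longrightarrow> y \<in> topspace X \<Longrightarrow> f y * g y = 0"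
    using I unfolding annihilating_ideals_cont_ring by blast
  let ?U = "{y \<in> topspace X. g y \<in> - {0}}"
  have "openin X ?U"
    using cont_ring_carrierD(1)[OF g] by (rule openin_continuous_map_preimage) auto
  moreover have "z \<in> ?U"
    using z by simp
  \<comment> \<open>Density of the isolated points in neighbourhood form, to be applied to the
    cozero set \<open>?U\<close> of \<open>g\<close>.\<close>
  moreover have "\<forall>T. z \<in> T \<and> openin X T \<longrightarrow> (\<exists>x. x \<in> isolated_points X \<and> x \<in> T)"
    using z(1) dense in_closure_of[of z X "isolated_points X"]
    unfolding almost_discrete_space_def by simp
  ultimately obtain x where x: "x \<in> isolated_points X" "x \<in> ?U"
    by meson
  interpret isolated_point X x
    using nonsing by (intro isolated_point.intro t1 x(1)) blast
  \<comment> \<open>At \<open>x\<close> the factor \<open>g x\<close> is nonzero, so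
    \<open>I\<close> is contained in \<open>M\<^sub>x\<close>, which \<open>E\<^sub>x\<close>
    annihilates.\<close>
  have Ix: "f x = 0" if "f \<in> I" for f
    using ann[OF that point_in_topspace] x(2) by auto
  have "f y * h y = 0"
    if "f \<in> I" "h \<in> vanishing_ideal X (topspace X - {x})" "y \<in> topspace X" for f h y
    using that Ix by (cases "y = x") (auto simp: vanishing_ideal_def)
  then have "(I, vanishing_ideal X (topspace X - {x})) \<in> parcs (annihilating_ideal_graph (cont_ring X))"
    unfolding annihilating_ideal_graph_cont_ring_arc_iff
    using I annihilating_ideals(2) by (intro conjI ballI)
  with x(1) show thesis by (rule that)
qed

lemma total_dominating_set_point_ideals:
  assumes "t1_space X" "almost_discrete_space X" "\<nexists>x. topspace X = {x}"
  shows "total_dominating_set (annihilating_ideal_graph (cont_ring X))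
           ((\<lambda>x. vanishing_ideal X (topspace X - {x})) ` isolated_points X)"
  unfolding total_dominating_set_def
proof (intro conjI ballI subsetI)
  fix I assume "I \<in> pverts (annihilating_ideal_graph (cont_ring X))"
  then have "I \<in> annihilating_ideals (cont_ring X)"
    by (simp add: annihilating_ideal_graph_def)
  then obtain x where "x \<in> isolated_points X"
    "(I, vanishing_ideal X (topspace X - {x})) \<in> parcs (annihilating_ideal_graph (cont_ring X))"
    using exists_dominating_isolated_point[OF assms] by blast
  then show "\<exists>J\<in>(\<lambda>x. vanishing_ideal X (topspace X - {x})) ` isolated_points X.
      (I, J) \<in> parcs (annihilating_ideal_graph (cont_ring X))"
    by blast
next
  fix I assume "I \<in> (\<lambda>x. vanishing_ideal X (topspace X - {x})) ` isolated_points X"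
  then obtain x where x: "x \<in> isolated_points X" "I = vanishing_ideal X (topspace X - {x})"
    by blast
  interpret isolated_point X x
    using assms(3) by (intro isolated_point.intro assms(1) x(1)) blast
  show "I \<in> pverts (annihilating_ideal_graph (cont_ring X))"
    using annihilating_ideals(2) by (simp add: x(2) annihilating_ideal_graph_def)
qed

section \<open>Injectivity of \<open>E\<^sub>x\<close> in \<open>x\<close>, and the two lower
  bounds\<close>

lemma inj_on_point_ideals:
  assumes "t1_space X" "\<nexists>x. topspace X = {x}"
  shows "inj_on (\<lambda>x. vanishing_ideal X (topspace X - {x})) (isolated_points X)"
proof (rule inj_onI)
  fix x y assume xy: "x \<in> isolated_points X" "y \<in> isolated_points X"
    "vanishing_ideal X (topspace X - {x}) = vanishing_ideal X (topspace X - {y})"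
  interpret isolated_point X x
    using assms(2) by (intro isolated_point.intro assms(1) xy(1)) blast
  show "x = y"
    by (rule point_unique[OF _ equalityD1[OF xy(3)]])
      (use xy(2) in \<open>simp add: isolated_points_def\<close>)
qed

lemma total_dominating_set_imp_dominating_set:
  "total_dominating_set G S \<Longrightarrow> dominating_set G S"
  unfolding total_dominating_set_def dominating_set_def by blast

lemma total_dominating_set_card_ge:
  assumes "t1_space X" "\<nexists>x. topspace X = {x}"
    and S: "total_dominating_set (annihilating_ideal_graph (cont_ring X)) S"
  shows "|isolated_points X| \<le>o |S|"
proof -
  have "vanishing_ideal X (topspace X - {x}) \<in> S" if "x \<in> isolated_points X" for x
  proof -
    interpret isolated_point X x
      using assms(2) by (intro isolated_point.intro assms(1) that) blast
    have "vanishing_ideal X {x} \<in> pverts (annihilating_ideal_graph (cont_ring X))"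
      using annihilating_ideals(1) by (simp add: annihilating_ideal_graph_def)
    with S show ?thesis
      unfolding total_dominating_set_def using unique_neighbour by blast
  qed
  then show ?thesis
    using inj_on_point_ideals[OF assms(1,2)] by (intro card_of_ordLeqI) auto
qed

lemma dominating_set_card_ge:
  assumes t1: "t1_space X" and three: "finite (topspace X) \<longrightarrow> card (topspace X) > 2"
    and D: "dominating_set (annihilating_ideal_graph (cont_ring X)) D"
  shows "|isolated_points X| \<le>o |D|"
proof -
  have third_point: "\<exists>z\<in>topspace X. z \<noteq> x \<and> z \<noteq> y" for x y
  proof (rule ccontr)
    assume "\<not> ?thesis"
    then have sub: "topspace X \<subseteq> {x, y}" by blast
    then have "finite (topspace X)" "card (topspace X) \<le> card {x, y}"
      by (auto intro: finite_subset card_mono)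
    with three show False
      \<comment> \<open>The bound \<open>card {x, y} \<le> 2\<close> also covers the case
        \<open>x = y\<close>, which is what rules out one-point spaces next.\<close>
      using card_insert_le_m1[of 2 "{y}" x] by fastforce
  qed
  then have nonsing: "\<nexists>x. topspace X = {x}"
    by blast
  have point: "isolated_point X x" if "x \<in> isolated_points X" for x
    using nonsing by (intro isolated_point.intro t1 that) blast
  let ?M = "\<lambda>x. vanishing_ideal X {x}" and ?E = "\<lambda>x. vanishing_ideal X (topspace X - {x})"
  \<comment> \<open>A dominating set may contain the vertex \<open>M\<^sub>x\<close> itself instead
    of its neighbour, so \<open>h\<close> selects whichever of the two is present, preferring
    \<open>M\<^sub>x\<close>.\<close>
  define h where "h x = (if ?M x \<in> D then ?M x else ?E x)" for x
  have in_D: "h x \<in> D" if "x \<in> isolated_points X" for x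
  proof -
    interpret isolated_point X x by (rule point[OF that])
    have "?M x \<in> pverts (annihilating_ideal_graph (cont_ring X))"
      using annihilating_ideals(1) by (simp add: annihilating_ideal_graph_def)
    with D have "?M x \<in> D \<or> ?E x \<in> D"
      unfolding dominating_set_def using unique_neighbour by blast
    then show ?thesis by (auto simp: h_def)
  qed
  \<comment> \<open>This needs a third point: in a space with exactly the points \<open>x\<close>
    and \<open>y\<close>, the ideals \<open>M\<^sub>x\<close> and \<open>E\<^sub>y\<close>
    coincide.\<close>
  have M_ne_E: "?M x \<noteq> ?E y" if "x \<in> isolated_points X" for x y
  proof -
    interpret isolated_point X x by (rule point[OF that])
    obtain z where z: "z \<in> topspace X" "z \<noteq> x" "z \<noteq> y"
      using third_point by blast
    then have "\<not> topspace X - {y} \<subseteq> {x}"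
      by blast
    then show ?thesis
      using vanishing_ideal_point_subset[of "topspace X - {y}"] by blast
  qed
  have M_inj: "x = y" if "x \<in> isolated_points X" "y \<in> isolated_points X" "?M x = ?M y" for x y
  proof -
    interpret isolated_point X x by (rule point[OF that(1)])
    have "{y} \<subseteq> {x}"
      using that(2)
      by (intro vanishing_ideal_point_subset equalityD1[OF that(3)]) (simp add: isolated_points_def)
    then show ?thesis by simp
  qed
  have "inj_on h (isolated_points X)"
  proof (rule inj_onI)
    fix x y assume xy: "x \<in> isolated_points X" "y \<in> isolated_points X" "h x = h y"
    then show "x = y"
      using M_inj[of x y] M_ne_E[of x y] M_ne_E[of y x]
        inj_onD[OF inj_on_point_ideals[OF t1 nonsing], of x y]
      unfolding h_def by (metis (full_types))
  qed
  with in_D show ?thesis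
    by (intro card_of_ordLeqI) auto
qed

text \<open>For a one-point space \<open>C(X)\<close> is a field, so the graph has no vertices and
  total domination number 0, although there is one isolated point; hence the premise of the first
  part. The premise of the second part is an implication because \<open>card\<close> is 0 on
  infinite sets.\<close>

theorem corollary4p5:
  fixes X :: "'a topology"
  assumes "tychonoff_space X" and "almost_discrete_space X"
  shows "((\<nexists>x. topspace X = {x}) \<longrightarrow>
           has_total_domination_number (annihilating_ideal_graph (cont_ring X)) |isolated_points X| ) \<and>
         ((finite (topspace X) \<longrightarrow> card (topspace X) > 2) \<longrightarrow>
           has_domination_number (annihilating_ideal_graph (cont_ring X)) |isolated_points X| )"
proof -
  let ?G = "annihilating_ideal_graph (cont_ring X)"
  let ?D = "(\<lambda>x. vanishing_ideal X (topspace X - {x})) ` isolated_points X"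
  have t1: "t1_space X"
    using assms(1) by (simp add: tychonoff_space_def Hausdorff_imp_t1_space)
  have attained: "total_dominating_set ?G ?D" "|?D| =o |isolated_points X|"
    if "\<nexists>x. topspace X = {x}"
    using total_dominating_set_point_ideals[OF t1 assms(2) that]
      inj_on_imp_bij_betw[OF inj_on_point_ideals[OF t1 that]]
    by (auto intro: ordIso_symmetric card_of_ordIsoI)
  show ?thesis
  proof (intro conjI impI)
    assume "\<nexists>x. topspace X = {x}"
    then show "has_total_domination_number ?G |isolated_points X|"
      unfolding has_total_domination_number_def is_min_cardinality_def
      using attained total_dominating_set_card_ge[OF t1] by blast
  next
    assume three: "finite (topspace X) \<longrightarrow> card (topspace X) > 2"
    then have "\<nexists>x. topspace X = {x}"
      by auto
    \<comment> \<open>The same set \<open>?D\<close> attains the minimum here, being in particular a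
      dominating set.\<close>
    then show "has_domination_number ?G |isolated_points X|"
      unfolding has_domination_number_def is_min_cardinality_def
      using attained total_dominating_set_imp_dominating_set dominating_set_card_ge[OF t1 three]
      by blast
  qed
qed

end
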